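(* Let $p^*:\mathcal D\to\mathcal C$ be a functor having a right adjoint $p_*$, with unit $\eta:1_{\mathcal D}\Rightarrow p_*p^*$. An arrow $f:d'\to d$ in $\mathcal D$ is cartesian for $p^*$ if and only if the naturality square $$\eta_d\circ f=p_*p^*(f)\circ\eta_{d'}$$ with sides $f:d'\to d$, $\eta_{d'}:d'\to p_*p^*(d')$, $\eta_d:d\to p_*p^*(d)$ and $p_*p^*(f)$, is a pullback square in $\mathcal D$.
   Context: For a functor $p:\mathcal D\to\mathcal C$, an arrow $f:d'\to d$ of $\mathcal D$ is cartesian if for every arrow $g:d''\to d$ in $\mathcal D$ and every arrow $h:p(d'')\to p(d')$ in $\mathcal C$ with $p(f)h=p(g)$ there is a unique $h':d''\to d'$ with $p(h')=h$ and $fh'=g$. *)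

theory Defs
  imports Main
begin

text \<open>Objects and arrows form subsets of the carrier types; all operations are constrained only on
  these subsets. \<open>g \<cdot>\<^bsub>C\<^esub> f\<close> is composition in the usual order (first \<open>f\<close>, then \<open>g\<close>).\<close>

record ('o, 'm) precat =
  Ob :: "'o set"
  Arr :: "'m set"
  Dom :: "'m \<Rightarrow> 'o"
  Cod :: "'m \<Rightarrow> 'o"
  Id :: "'o \<Rightarrow> 'm"
  Comp :: "'m \<Rightarrow> 'm \<Rightarrow> 'm" (infixl "\<cdot>\<index>" 70)

definition Hom :: "('o, 'm) precat \<Rightarrow> 'o \<Rightarrow> 'o \<Rightarrow> 'm set" where
  "Hom C a b = {f \<in> Arr C. Dom C f = a \<and> Cod C f = b}"

locale category =
  fixes C :: "('o, 'm) precat"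
  assumes Dom_in_Ob: "f \<in> Arr C \<Longrightarrow> Dom C f \<in> Ob C"
    and Cod_in_Ob: "f \<in> Arr C \<Longrightarrow> Cod C f \<in> Ob C"
    and Id_in_Hom: "a \<in> Ob C \<Longrightarrow> Id C a \<in> Hom C a a"
    and Comp_in_Hom: "f \<in> Hom C a b \<Longrightarrow> g \<in> Hom C b c \<Longrightarrow> g \<cdot>\<^bsub>C\<^esub> f \<in> Hom C a c"
    and Comp_Id_left: "f \<in> Hom C a b \<Longrightarrow> Id C b \<cdot>\<^bsub>C\<^esub> f = f"
    and Comp_Id_right: "f \<in> Hom C a b \<Longrightarrow> f \<cdot>\<^bsub>C\<^esub> Id C a = f"
    and Comp_assoc: "f \<in> Hom C a b \<Longrightarrow> g \<in> Hom C b c \<Longrightarrow> h \<in> Hom C c d \<Longrightarrow>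
      (h \<cdot>\<^bsub>C\<^esub> g) \<cdot>\<^bsub>C\<^esub> f = h \<cdot>\<^bsub>C\<^esub> (g \<cdot>\<^bsub>C\<^esub> f)"

record ('o1, 'm1, 'o2, 'm2) prefunctor =
  ob_map :: "'o1 \<Rightarrow> 'o2"
  ar_map :: "'m1 \<Rightarrow> 'm2"

locale cat_functor = dom: category A + cod: category B
  for A :: "('o1, 'm1) precat" and B :: "('o2, 'm2) precat" +
  fixes F :: "('o1, 'm1, 'o2, 'm2) prefunctor"
  assumes ob_map_in_Ob: "a \<in> Ob A \<Longrightarrow> ob_map F a \<in> Ob B"
    and ar_map_in_Hom: "f \<in> Hom A a b \<Longrightarrow> ar_map F f \<in> Hom B (ob_map F a) (ob_map F b)"
    and ar_map_Id: "a \<in> Ob A \<Longrightarrow> ar_map F (Id A a) = Id B (ob_map F a)"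
    and ar_map_Comp: "f \<in> Hom A a b \<Longrightarrow> g \<in> Hom A b c \<Longrightarrow>
      ar_map F (g \<cdot>\<^bsub>A\<^esub> f) = ar_map F g \<cdot>\<^bsub>B\<^esub> ar_map F f"

definition id_functor :: "('o, 'm, 'o, 'm) prefunctor" where
  "id_functor = \<lparr>ob_map = (\<lambda>a. a), ar_map = (\<lambda>f. f)\<rparr>"

definition comp_functor ::
  "('o2, 'm2, 'o3, 'm3) prefunctor \<Rightarrow> ('o1, 'm1, 'o2, 'm2) prefunctor \<Rightarrow>
    ('o1, 'm1, 'o3, 'm3) prefunctor" (infixl "\<circ>\<^sub>F" 55) where
  "G \<circ>\<^sub>F F = \<lparr>ob_map = (\<lambda>a. ob_map G (ob_map F a)), ar_map = (\<lambda>f. ar_map G (ar_map F f))\<rparr>"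

locale nat_trans = src: cat_functor A B F + tgt: cat_functor A B G
  for A :: "('o1, 'm1) precat" and B :: "('o2, 'm2) precat"
    and F G :: "('o1, 'm1, 'o2, 'm2) prefunctor" +
  fixes \<tau> :: "'o1 \<Rightarrow> 'm2"
  assumes component_in_Hom: "a \<in> Ob A \<Longrightarrow> \<tau> a \<in> Hom B (ob_map F a) (ob_map G a)"
    and naturality: "f \<in> Hom A a b \<Longrightarrow> \<tau> b \<cdot>\<^bsub>B\<^esub> ar_map F f = ar_map G f \<cdot>\<^bsub>B\<^esub> \<tau> a"

text \<open>\<open>L : D \<rightarrow> C\<close> is left adjoint to \<open>R : C \<rightarrow> D\<close>, with unit \<open>\<eta>\<close> and counit \<open>\<epsilon>\<close> satisfying the
  triangle identities.\<close>

locale adjunction =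
  left: cat_functor D C L + right: cat_functor C D R +
  unit: nat_trans D D id_functor "R \<circ>\<^sub>F L" \<eta> +
  counit: nat_trans C C "L \<circ>\<^sub>F R" id_functor \<epsilon>
  for D :: "('o1, 'm1) precat" and C :: "('o2, 'm2) precat"
    and L :: "('o1, 'm1, 'o2, 'm2) prefunctor" and R :: "('o2, 'm2, 'o1, 'm1) prefunctor"
    and \<eta> :: "'o1 \<Rightarrow> 'm1" and \<epsilon> :: "'o2 \<Rightarrow> 'm2" +
  assumes triangle_left:
      "d \<in> Ob D \<Longrightarrow> \<epsilon> (ob_map L d) \<cdot>\<^bsub>C\<^esub> ar_map L (\<eta> d) = Id C (ob_map L d)"
    and triangle_right:
      "c \<in> Ob C \<Longrightarrow> ar_map R (\<epsilon> c) \<cdot>\<^bsub>D\<^esub> \<eta> (ob_map R c) = Id D (ob_map R c)"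

definition cartesian_arrow ::
  "('o1, 'm1) precat \<Rightarrow> ('o2, 'm2) precat \<Rightarrow> ('o1, 'm1, 'o2, 'm2) prefunctor \<Rightarrow> 'm1 \<Rightarrow> bool" where
  "cartesian_arrow D C p f \<longleftrightarrow> f \<in> Arr D \<and>
    (\<forall>d'' g h. g \<in> Hom D d'' (Cod D f) \<longrightarrow>
      h \<in> Hom C (ob_map p d'') (ob_map p (Dom D f)) \<longrightarrow>
      ar_map p f \<cdot>\<^bsub>C\<^esub> h = ar_map p g \<longrightarrow>
      (\<exists>!h'. h' \<in> Hom D d'' (Dom D f) \<and> ar_map p h' = h \<and> f \<cdot>\<^bsub>D\<^esub> h' = g))"

text \<open>\<open>pullback_square C p q k l\<close>: the square \<open>k \<cdot> p = l \<cdot> q\<close> exhibits the common domain of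
  \<open>p\<close> and \<open>q\<close> as the pullback of the cospan \<open>k, l\<close>.\<close>

definition pullback_square :: "('o, 'm) precat \<Rightarrow> 'm \<Rightarrow> 'm \<Rightarrow> 'm \<Rightarrow> 'm \<Rightarrow> bool" where
  "pullback_square C p q k l \<longleftrightarrow>
    (\<exists>w a b c. p \<in> Hom C w a \<and> q \<in> Hom C w b \<and> k \<in> Hom C a c \<and> l \<in> Hom C b c \<and>
      k \<cdot>\<^bsub>C\<^esub> p = l \<cdot>\<^bsub>C\<^esub> q \<and>
      (\<forall>x s t. s \<in> Hom C x a \<longrightarrow> t \<in> Hom C x b \<longrightarrow> k \<cdot>\<^bsub>C\<^esub> s = l \<cdot>\<^bsub>C\<^esub> t \<longrightarrow>
        (\<exists>!u. u \<in> Hom C x w \<and> p \<cdot>\<^bsub>C\<^esub> u = s \<and> q \<cdot>\<^bsub>C\<^esub> u = t)))"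

end

theory Submission
  imports Defs
begin

text \<open>Write \<open>L\<close> for the left adjoint and \<open>R\<close> for its right adjoint. The proof rewrites the
  universal property of the naturality square along the adjunction bijection
  \<open>h \<mapsto> R h \<cdot> \<eta> x\<close> from arrows \<open>L x \<rightarrow> c\<close> to arrows \<open>x \<rightarrow> R c\<close>
  (lemma \<open>transpose_bij_betw\<close>).

  A cone with vertex \<open>x\<close> over the cospan \<open>\<eta> d\<close>, \<open>R (L f)\<close> consists of \<open>g : x \<rightarrow> d\<close> and
  \<open>t : x \<rightarrow> R (L d')\<close>, and \<open>t\<close> is the transpose of a unique \<open>h : L x \<rightarrow> L d'\<close>. By naturality of
  \<open>\<eta>\<close>, the arrow \<open>\<eta> d \<cdot> g\<close> is the transpose of \<open>L g\<close>, while \<open>R (L f) \<cdot> t\<close> is the transpose of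
  \<open>L f \<cdot> h\<close>; so the cone commutes exactly when \<open>L f \<cdot> h = L g\<close>
  (\<open>cone_commutes_iff_factors\<close>). Likewise \<open>\<eta> d' \<cdot> u\<close> is the transpose of \<open>L u\<close>, so an arrow
  \<open>u : x \<rightarrow> d'\<close> with \<open>f \<cdot> u = g\<close> is a map of cones exactly when \<open>L u = h\<close>
  (\<open>unit_comp_eq_transpose_iff\<close>). Hence the cones with their factorizations are precisely the
  lifting problems and lifts that define a cartesian arrow.\<close>

lemma pullback_square_iff:
  assumes "p \<in> Hom C w a" "q \<in> Hom C w b" "k \<in> Hom C a c" "l \<in> Hom C b c"
    and "k \<cdot>\<^bsub>C\<^esub> p = l \<cdot>\<^bsub>C\<^esub> q"
  shows "pullback_square C p q k l \<longleftrightarrow>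
    (\<forall>x s t. s \<in> Hom C x a \<longrightarrow> t \<in> Hom C x b \<longrightarrow> k \<cdot>\<^bsub>C\<^esub> s = l \<cdot>\<^bsub>C\<^esub> t \<longrightarrow>
      (\<exists>!u. u \<in> Hom C x w \<and> p \<cdot>\<^bsub>C\<^esub> u = s \<and> q \<cdot>\<^bsub>C\<^esub> u = t))"
    (is "_ \<longleftrightarrow> ?universal w a b")
proof
  assume "pullback_square C p q k l"
  then obtain w' a' b' where "p \<in> Hom C w' a'" "q \<in> Hom C w' b'" "?universal w' a' b'"
    unfolding pullback_square_def by blast
  moreover from this(1,2) assms(1,2) have "w' = w" "a' = a" "b' = b"
    by (auto simp: Hom_def)
  ultimately show "?universal w a b" by simp
next
  assume "?universal w a b"
  with assms show "pullback_square C p q k l"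
    unfolding pullback_square_def by blast
qed

lemma (in category) Hom_Ob:
  assumes "f \<in> Hom C a b"
  shows "a \<in> Ob C" "b \<in> Ob C"
  using assms Dom_in_Ob Cod_in_Ob by (auto simp: Hom_def)

context adjunction
begin

definition transpose :: "'o1 \<Rightarrow> 'm2 \<Rightarrow> 'm1" where
  "transpose x h = ar_map R h \<cdot>\<^bsub>D\<^esub> \<eta> x"

lemma unit_in_Hom: "x \<in> Ob D \<Longrightarrow> \<eta> x \<in> Hom D x (ob_map R (ob_map L x))"
  using unit.component_in_Hom by (simp add: id_functor_def comp_functor_def)

lemma counit_in_Hom: "c \<in> Ob C \<Longrightarrow> \<epsilon> c \<in> Hom C (ob_map L (ob_map R c)) c"
  using counit.component_in_Hom by (simp add: id_functor_def comp_functor_def)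

lemma unit_naturality:
  "u \<in> Hom D x y \<Longrightarrow> \<eta> y \<cdot>\<^bsub>D\<^esub> u = ar_map R (ar_map L u) \<cdot>\<^bsub>D\<^esub> \<eta> x"
  using unit.naturality by (simp add: id_functor_def comp_functor_def)

lemma counit_naturality:
  "h \<in> Hom C b c \<Longrightarrow> \<epsilon> c \<cdot>\<^bsub>C\<^esub> ar_map L (ar_map R h) = h \<cdot>\<^bsub>C\<^esub> \<epsilon> b"
  using counit.naturality by (simp add: id_functor_def comp_functor_def)

lemma transpose_in_Hom:
  assumes "x \<in> Ob D" "h \<in> Hom C (ob_map L x) c"
  shows "transpose x h \<in> Hom D x (ob_map R c)"
  unfolding transpose_def
  using left.dom.Comp_in_Hom[OF unit_in_Hom right.ar_map_in_Hom] assms .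

text \<open>The inverse of transposition is \<open>t \<mapsto> \<epsilon> c \<cdot> L t\<close>: each composite reduces to the identity by
  moving a unit or counit past an arrow by naturality and then cancelling it by a triangle
  identity.\<close>

lemma transpose_bij_betw:
  assumes x: "x \<in> Ob D" and c: "c \<in> Ob C"
  shows "bij_betw (transpose x) (Hom C (ob_map L x) c) (Hom D x (ob_map R c))"
proof (rule bij_betw_byWitness[where f' = "\<lambda>t. \<epsilon> c \<cdot>\<^bsub>C\<^esub> ar_map L t"])
  show "\<forall>h\<in>Hom C (ob_map L x) c. \<epsilon> c \<cdot>\<^bsub>C\<^esub> ar_map L (transpose x h) = h"
  proof
    fix h assume h: "h \<in> Hom C (ob_map L x) c"
    have Rh: "ar_map R h \<in> Hom D (ob_map R (ob_map L x)) (ob_map R c)"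
      using right.ar_map_in_Hom[OF h] .
    have Lx: "ob_map L x \<in> Ob C"
      using left.ob_map_in_Ob[OF x] .
    have "\<epsilon> c \<cdot>\<^bsub>C\<^esub> ar_map L (transpose x h)
        = \<epsilon> c \<cdot>\<^bsub>C\<^esub> (ar_map L (ar_map R h) \<cdot>\<^bsub>C\<^esub> ar_map L (\<eta> x))"
      unfolding transpose_def using left.ar_map_Comp[OF unit_in_Hom[OF x] Rh] by simp
    also have "\<dots> = (\<epsilon> c \<cdot>\<^bsub>C\<^esub> ar_map L (ar_map R h)) \<cdot>\<^bsub>C\<^esub> ar_map L (\<eta> x)"
      using left.cod.Comp_assoc[OF left.ar_map_in_Hom[OF unit_in_Hom[OF x]]
          left.ar_map_in_Hom[OF Rh] counit_in_Hom[OF c]] by simp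
    also have "\<dots> = (h \<cdot>\<^bsub>C\<^esub> \<epsilon> (ob_map L x)) \<cdot>\<^bsub>C\<^esub> ar_map L (\<eta> x)"
      using counit_naturality[OF h] by simp
    also have "\<dots> = h \<cdot>\<^bsub>C\<^esub> (\<epsilon> (ob_map L x) \<cdot>\<^bsub>C\<^esub> ar_map L (\<eta> x))"
      using left.cod.Comp_assoc[OF left.ar_map_in_Hom[OF unit_in_Hom[OF x]]
          counit_in_Hom[OF Lx] h] .
    also have "\<dots> = h"
      using triangle_left[OF x] left.cod.Comp_Id_right[OF h] by simp
    finally show "\<epsilon> c \<cdot>\<^bsub>C\<^esub> ar_map L (transpose x h) = h" .
  qed
next
  show "\<forall>t\<in>Hom D x (ob_map R c). transpose x (\<epsilon> c \<cdot>\<^bsub>C\<^esub> ar_map L t) = t"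
  proof
    fix t assume t: "t \<in> Hom D x (ob_map R c)"
    have Lt: "ar_map L t \<in> Hom C (ob_map L x) (ob_map L (ob_map R c))"
      using left.ar_map_in_Hom[OF t] .
    have Rc: "ob_map R c \<in> Ob D"
      using right.ob_map_in_Ob[OF c] .
    have "transpose x (\<epsilon> c \<cdot>\<^bsub>C\<^esub> ar_map L t)
        = (ar_map R (\<epsilon> c) \<cdot>\<^bsub>D\<^esub> ar_map R (ar_map L t)) \<cdot>\<^bsub>D\<^esub> \<eta> x"
      unfolding transpose_def using right.ar_map_Comp[OF Lt counit_in_Hom[OF c]] by simp
    also have "\<dots> = ar_map R (\<epsilon> c) \<cdot>\<^bsub>D\<^esub> (ar_map R (ar_map L t) \<cdot>\<^bsub>D\<^esub> \<eta> x)"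
      using left.dom.Comp_assoc[OF unit_in_Hom[OF x] right.ar_map_in_Hom[OF Lt]
          right.ar_map_in_Hom[OF counit_in_Hom[OF c]]] .
    also have "\<dots> = ar_map R (\<epsilon> c) \<cdot>\<^bsub>D\<^esub> (\<eta> (ob_map R c) \<cdot>\<^bsub>D\<^esub> t)"
      using unit_naturality[OF t] by simp
    also have "\<dots> = (ar_map R (\<epsilon> c) \<cdot>\<^bsub>D\<^esub> \<eta> (ob_map R c)) \<cdot>\<^bsub>D\<^esub> t"
      using left.dom.Comp_assoc[OF t unit_in_Hom[OF Rc]
          right.ar_map_in_Hom[OF counit_in_Hom[OF c]]] by simp
    also have "\<dots> = t"
      using triangle_right[OF c] left.dom.Comp_Id_left[OF t] by simp
    finally show "transpose x (\<epsilon> c \<cdot>\<^bsub>C\<^esub> ar_map L t) = t" .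
  qed
next
  show "transpose x ` Hom C (ob_map L x) c \<subseteq> Hom D x (ob_map R c)"
    using transpose_in_Hom[OF x] by blast
next
  show "(\<lambda>t. \<epsilon> c \<cdot>\<^bsub>C\<^esub> ar_map L t) ` Hom D x (ob_map R c) \<subseteq> Hom C (ob_map L x) c"
    using left.cod.Comp_in_Hom[OF left.ar_map_in_Hom counit_in_Hom[OF c]] by blast
qed

lemma transpose_eq_iff:
  assumes "x \<in> Ob D" "h \<in> Hom C (ob_map L x) c" "k \<in> Hom C (ob_map L x) c"
  shows "transpose x h = transpose x k \<longleftrightarrow> h = k"
  using transpose_bij_betw[OF assms(1) left.cod.Hom_Ob(2)[OF assms(2)]] assms(2,3)
  by (auto simp: bij_betw_def inj_on_def)

lemma unit_comp_eq_transpose: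
  "u \<in> Hom D x y \<Longrightarrow> \<eta> y \<cdot>\<^bsub>D\<^esub> u = transpose x (ar_map L u)"
  unfolding transpose_def by (rule unit_naturality)

lemma unit_comp_eq_transpose_iff:
  assumes u: "u \<in> Hom D x y" and h: "h \<in> Hom C (ob_map L x) (ob_map L y)"
  shows "\<eta> y \<cdot>\<^bsub>D\<^esub> u = transpose x h \<longleftrightarrow> ar_map L u = h"
  unfolding unit_comp_eq_transpose[OF u]
  using transpose_eq_iff[OF left.dom.Hom_Ob(1)[OF u] left.ar_map_in_Hom[OF u] h] .

lemma transpose_Comp:
  assumes x: "x \<in> Ob D" and h: "h \<in> Hom C (ob_map L x) b" and k: "k \<in> Hom C b c"
  shows "transpose x (k \<cdot>\<^bsub>C\<^esub> h) = ar_map R k \<cdot>\<^bsub>D\<^esub> transpose x h"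
  unfolding transpose_def right.ar_map_Comp[OF h k]
  using left.dom.Comp_assoc[OF unit_in_Hom[OF x] right.ar_map_in_Hom[OF h]
      right.ar_map_in_Hom[OF k]] .

lemma cone_commutes_iff_factors:
  assumes f: "f \<in> Hom D d' d" and g: "g \<in> Hom D x d"
    and h: "h \<in> Hom C (ob_map L x) (ob_map L d')"
  shows "\<eta> d \<cdot>\<^bsub>D\<^esub> g = ar_map R (ar_map L f) \<cdot>\<^bsub>D\<^esub> transpose x h
    \<longleftrightarrow> ar_map L f \<cdot>\<^bsub>C\<^esub> h = ar_map L g"
proof -
  have x: "x \<in> Ob D" using left.dom.Hom_Ob(1)[OF g] .
  have "ar_map R (ar_map L f) \<cdot>\<^bsub>D\<^esub> transpose x h = transpose x (ar_map L f \<cdot>\<^bsub>C\<^esub> h)"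
    using transpose_Comp[OF x h left.ar_map_in_Hom[OF f]] by simp
  then show ?thesis
    using unit_comp_eq_transpose_iff[OF g left.cod.Comp_in_Hom[OF h left.ar_map_in_Hom[OF f]]]
    by auto
qed

lemma cartesian_arrow_iff_pullback_square:
  assumes f: "f \<in> Hom D d' d"
  shows "cartesian_arrow D C L f \<longleftrightarrow>
    pullback_square D f (\<eta> d') (\<eta> d) (ar_map (R \<circ>\<^sub>F L) f)"
proof -
  let ?H = "\<lambda>x. Hom C (ob_map L x) (ob_map L d')"
  let ?RLf = "ar_map R (ar_map L f)"
  let ?lift = "\<lambda>x g h. \<exists>!u. u \<in> Hom D x d' \<and> ar_map L u = h \<and> f \<cdot>\<^bsub>D\<^esub> u = g"
  let ?fac = "\<lambda>x g t. \<exists>!u. u \<in> Hom D x d' \<and> f \<cdot>\<^bsub>D\<^esub> u = g \<and> \<eta> d' \<cdot>\<^bsub>D\<^esub> u = t"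
  have f_Arr: "f \<in> Arr D" and Dom_f: "Dom D f = d'" and Cod_f: "Cod D f = d"
    using f by (auto simp: Hom_def)
  note d' = left.dom.Hom_Ob(1)[OF f] and d = left.dom.Hom_Ob(2)[OF f]
  have fac_iff_lift: "?fac x g (transpose x h) \<longleftrightarrow> ?lift x g h" if h: "h \<in> ?H x" for x g h
  proof -
    have "u \<in> Hom D x d' \<and> f \<cdot>\<^bsub>D\<^esub> u = g \<and> \<eta> d' \<cdot>\<^bsub>D\<^esub> u = transpose x h
        \<longleftrightarrow> u \<in> Hom D x d' \<and> ar_map L u = h \<and> f \<cdot>\<^bsub>D\<^esub> u = g" for u
      using unit_comp_eq_transpose_iff[OF _ h] by blast
    then show ?thesis by simp
  qed
  have transposes: "Hom D x (ob_map R (ob_map L d')) = transpose x ` ?H x" if "x \<in> Ob D" for x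
    using transpose_bij_betw[OF that left.ob_map_in_Ob[OF d']] by (simp add: bij_betw_def)
  have ball_transpose: "(\<forall>g \<in> Hom D x d. \<forall>h \<in> ?H x. P g (transpose x h))
      \<longleftrightarrow> (\<forall>g \<in> Hom D x d. \<forall>t \<in> Hom D x (ob_map R (ob_map L d')). P g t)" for x P
    by (rule ball_cong[OF refl]) (simp add: transposes[OF left.dom.Hom_Ob(1)])
  have "cartesian_arrow D C L f \<longleftrightarrow>
      (\<forall>x. \<forall>g \<in> Hom D x d. \<forall>h \<in> ?H x. ar_map L f \<cdot>\<^bsub>C\<^esub> h = ar_map L g \<longrightarrow> ?lift x g h)"
    unfolding cartesian_arrow_def Dom_f Cod_f using f_Arr by blast
  also have "\<dots> \<longleftrightarrow> (\<forall>x. \<forall>g \<in> Hom D x d. \<forall>h \<in> ?H x.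
      \<eta> d \<cdot>\<^bsub>D\<^esub> g = ?RLf \<cdot>\<^bsub>D\<^esub> transpose x h \<longrightarrow> ?fac x g (transpose x h))"
    by (simp only: cone_commutes_iff_factors[OF f] fac_iff_lift cong: ball_cong)
  also have "\<dots> \<longleftrightarrow> (\<forall>x. \<forall>g \<in> Hom D x d. \<forall>t \<in> Hom D x (ob_map R (ob_map L d')).
      \<eta> d \<cdot>\<^bsub>D\<^esub> g = ?RLf \<cdot>\<^bsub>D\<^esub> t \<longrightarrow> ?fac x g t)"
    by (intro iff_allI ball_transpose[where P = "\<lambda>g t.
        \<eta> d \<cdot>\<^bsub>D\<^esub> g = ?RLf \<cdot>\<^bsub>D\<^esub> t \<longrightarrow> ?fac _ g t"])
  also have "\<dots> \<longleftrightarrow> pullback_square D f (\<eta> d') (\<eta> d) ?RLf"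
    unfolding pullback_square_iff[OF f unit_in_Hom[OF d'] unit_in_Hom[OF d]
        right.ar_map_in_Hom[OF left.ar_map_in_Hom[OF f]] unit_naturality[OF f]]
    by blast
  finally show ?thesis by (simp add: comp_functor_def)
qed

end

theorem proposition5p1p1:
  fixes D :: "('o1, 'm1) precat" and C :: "('o2, 'm2) precat"
    and p_up :: "('o1, 'm1, 'o2, 'm2) prefunctor" and p_down :: "('o2, 'm2, 'o1, 'm1) prefunctor"
    and \<eta> :: "'o1 \<Rightarrow> 'm1" and \<epsilon> :: "'o2 \<Rightarrow> 'm2"
    and d' d :: 'o1 and f :: 'm1
  assumes "adjunction D C p_up p_down \<eta> \<epsilon>"
    and "f \<in> Hom D d' d"
  shows "cartesian_arrow D C p_up f \<longleftrightarrow>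
    pullback_square D f (\<eta> d') (\<eta> d) (ar_map (p_down \<circ>\<^sub>F p_up) f)"
  using assms by (rule adjunction.cartesian_arrow_iff_pullback_square)

end
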